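(* Let $p$ be a prime number with $p\equiv 1\pmod{3}$. Then the cubic congruence $x^{3}\equiv 2\pmod{p}$ is solvable (in integers $x$) if and only if there exist integers $C$ and $D$ such that $p=C^{2}+27D^{2}$. *)

theory Defs
  imports "HOL-Number_Theory.Number_Theory"
begin

end

theory Submission
  imports Defs
begin

text \<open>
  Let \<open>\<chi>\<close> be a cubic character modulo \<open>p\<close>, with values in the Eisenstein integers
  \<open>\<int>[\<omega>]\<close>, so that 2 is a cube modulo \<open>p\<close> exactly when \<open>\<chi> 2 = 1\<close>. Everything is
  read off from the Jacobi sum \<open>J = (\<Sum>t. \<chi> t * \<chi> (1 - t))\<close>, an Eisenstein integer
  \<open>a + b \<omega>\<close>, by way of three facts.

  \<^item> Its norm \<open>a\<^sup>2 - a b + b\<^sup>2\<close> is \<open>p\<close> (\<open>jacobi_sum_norm\<close>).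
  \<^item> It is congruent to \<open>- p\<close> modulo 3 (\<open>jacobi_sum_mod_3\<close>), so \<open>b = 3 B\<close> and
    \<open>4 p = (2 a - 3 B)\<^sup>2 + 27 B\<^sup>2\<close>.
  \<^item> It is congruent to \<open>\<chi> 2\<close> modulo 2 (\<open>jacobi_sum_mod_2\<close>): the involution
    \<open>t \<mapsto> 1 - t\<close> pairs off all terms except the one at \<open>t = 1 / 2\<close>. Among
    the cube roots of unity 1, \<open>\<omega>\<close> and \<open>- 1 - \<omega>\<close>, only 1 has an even
    \<open>\<omega>\<close>-coordinate, so \<open>\<chi> 2 = 1\<close> if and only if \<open>B\<close> is even.

  If \<open>B = 2 D\<close>, then \<open>p = (a - 3 D)\<^sup>2 + 27 D\<^sup>2\<close>. Conversely, from
  \<open>p = C\<^sup>2 + 27 D\<^sup>2\<close> one gets the second representation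
  \<open>4 p = (2 C)\<^sup>2 + 27 (2 D)\<^sup>2\<close>; representations of \<open>4 p\<close> by \<open>x\<^sup>2 + 27 y\<^sup>2\<close> are unique
  up to signs, which forces \<open>B\<close> to be even (\<open>representation_parity\<close>).
\<close>

section \<open>Eisenstein integers\<close>

definition omega :: complex where
  "omega = Complex (- 1 / 2) (sqrt 3 / 2)"

definition eisenstein :: "complex set" where
  "eisenstein = {of_int a + of_int b * omega | a b. True}"

lemma omega_squared: "omega ^ 2 = - 1 - omega"
  by (simp add: omega_def complex_eq_iff power2_eq_square)

lemma omega_cubed: "omega ^ 3 = 1"
proof -
  have "omega ^ 3 = omega * omega ^ 2" by (simp add: eval_nat_numeral)
  also have "\<dots> = omega * (- 1 - omega)" by (simp only: omega_squared)
  also have "\<dots> = - omega - omega ^ 2" by (simp add: algebra_simps power2_eq_square)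
  also have "\<dots> = 1" by (simp add: omega_squared)
  finally show ?thesis .
qed

lemma omega_neq_1: "omega \<noteq> 1"
  by (simp add: omega_def complex_eq_iff)

lemma omega_power_cong:
  assumes "[i = j] (mod 3)"
  shows "omega ^ i = omega ^ j"
proof -
  have "omega ^ k = omega ^ (k mod 3)" for k
  proof -
    have "omega ^ k = omega ^ (3 * (k div 3) + k mod 3)" by simp
    also have "\<dots> = omega ^ (k mod 3)" unfolding power_add power_mult omega_cubed by simp
    finally show ?thesis .
  qed
  then show ?thesis using assms unfolding cong_def by metis
qed

lemma omega_power_eq_1_imp:
  assumes "omega ^ i = 1"
  shows "3 dvd i"
proof -
  have "omega ^ (i mod 3) = 1"
    using assms omega_power_cong[of i "i mod 3"] by (simp add: cong_def)
  moreover have "i mod 3 = 0 \<or> i mod 3 = 1 \<or> i mod 3 = 2" by presburger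
  moreover have "- 1 - omega \<noteq> 1" by (simp add: omega_def complex_eq_iff)
  ultimately show ?thesis using omega_neq_1 omega_squared by (auto simp: dvd_eq_mod_eq_0)
qed

lemma cube_root_of_unity_cases:
  fixes z :: complex
  assumes "z ^ 3 = 1"
  shows "z = 1 \<or> z = omega \<or> z = - 1 - omega"
proof -
  have "(z - 1) * ((z - omega) * (z - (- 1 - omega))) = (z - 1) * (z ^ 2 + z - omega - omega ^ 2)"
    by (simp add: algebra_simps power2_eq_square)
  also have "\<dots> = z ^ 3 - 1"
    by (simp add: omega_squared) (simp add: algebra_simps eval_nat_numeral)
  finally show ?thesis using assms by auto
qed

lemma eisensteinI: "z = of_int a + of_int b * omega \<Longrightarrow> z \<in> eisenstein"
  unfolding eisenstein_def by blast

lemma eisensteinE: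
  assumes "z \<in> eisenstein"
  obtains a b where "z = of_int a + of_int b * omega"
  using assms unfolding eisenstein_def by blast

lemma eisenstein_of_int: "of_int a \<in> eisenstein"
  by (rule eisensteinI[of _ a 0]) simp

lemma eisenstein_add:
  assumes "x \<in> eisenstein" "y \<in> eisenstein"
  shows "x + y \<in> eisenstein"
proof -
  obtain a b c d where "x = of_int a + of_int b * omega" "y = of_int c + of_int d * omega"
    using assms by (metis eisensteinE)
  then show ?thesis
    by (intro eisensteinI[of _ "a + c" "b + d"]) (simp add: algebra_simps)
qed

lemma eisenstein_mult:
  assumes "x \<in> eisenstein" "y \<in> eisenstein"
  shows "x * y \<in> eisenstein"
proof -
  obtain a b c d where *: "x = of_int a + of_int b * omega" "y = of_int c + of_int d * omega"
    using assms by (metis eisensteinE)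
  have "x * y = of_int (a * c) + of_int (a * d + b * c) * omega + of_int (b * d) * omega ^ 2"
    unfolding * by (simp add: algebra_simps power2_eq_square)
  also have "\<dots> = of_int (a * c - b * d) + of_int (a * d + b * c - b * d) * omega"
    by (simp add: omega_squared algebra_simps)
  finally show ?thesis by (rule eisensteinI)
qed

lemma eisenstein_sum:
  assumes "\<And>x. x \<in> A \<Longrightarrow> f x \<in> eisenstein"
  shows "sum f A \<in> eisenstein"
  using assms
  by (induction A rule: infinite_finite_induct)
     (auto intro: eisenstein_add eisenstein_of_int[of 0, simplified])

lemma eisenstein_cube_root_of_unity:
  assumes "z ^ 3 = 1"
  shows "z \<in> eisenstein"
  using cube_root_of_unity_cases[OF assms] eisensteinI[of z 1 0] eisensteinI[of z 0 1]
    eisensteinI[of z "-1" "-1"] by auto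

lemma eisenstein_coords_unique:
  assumes "of_int a + of_int b * omega = of_int c + of_int d * omega"
  shows "a = c" "b = d"
proof -
  show "b = d"
    using arg_cong[OF assms, of Im] by (simp add: omega_def)
  then show "a = c"
    using assms by simp
qed

lemma eisenstein_norm:
  "(of_int a + of_int b * omega) * cnj (of_int a + of_int b * omega)
     = of_int (a\<^sup>2 - a * b + b\<^sup>2)"
  by (simp add: complex_eq_iff omega_def power2_eq_square algebra_simps)

lemma one_minus_cube_root_of_unity:
  assumes "z ^ 3 = 1"
  obtains e where "e \<in> eisenstein" "1 - z = (1 - omega) * e"
proof -
  from cube_root_of_unity_cases[OF assms]
  consider "z = 1" | "z = omega" | "z = - 1 - omega" by blast
  then show thesis
  proof cases
    case 1
    then show ?thesis using that[of 0] eisenstein_of_int[of 0] by simp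
  next
    case 2
    then show ?thesis using that[of 1] eisenstein_of_int[of 1] by simp
  next
    case 3
    have "(1 - omega) * (1 + omega) = 1 - omega ^ 2" by (simp add: algebra_simps power2_eq_square)
    then have "1 - z = (1 - omega) * (1 + omega)" by (simp add: 3 omega_squared)
    then show ?thesis
      using that[of "1 + omega"] eisensteinI[of "1 + omega" 1 1] by simp
  qed
qed

text \<open>
  Each factor is a multiple of \<open>1 - omega\<close>, whose square is \<open>- 3 * omega\<close>: this is
  the ramification of 3 in the Eisenstein integers.
\<close>

lemma one_minus_cube_roots_prod:
  assumes "y ^ 3 = 1" "z ^ 3 = 1"
  obtains e where "e \<in> eisenstein" "(1 - y) * (1 - z) = 3 * e"
proof -
  obtain u v where u: "u \<in> eisenstein" "1 - y = (1 - omega) * u"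
    and v: "v \<in> eisenstein" "1 - z = (1 - omega) * v"
    using assms one_minus_cube_root_of_unity by metis
  have "(1 - omega) * (1 - omega) = 1 - 2 * omega + omega ^ 2"
    by (simp add: algebra_simps power2_eq_square)
  also have "\<dots> = 3 * (- omega)" by (simp add: omega_squared)
  finally have "(1 - omega) * (1 - omega) = 3 * (- omega)" .
  moreover have "(1 - y) * (1 - z) = ((1 - omega) * (1 - omega)) * (u * v)"
    unfolding u(2) v(2) by (simp only: mult_ac)
  ultimately have "(1 - y) * (1 - z) = 3 * (- omega) * (u * v)" by simp
  then show thesis
    using that[of "- omega * (u * v)"] eisenstein_mult[OF eisensteinI[of "- omega" 0 "-1"]]
      eisenstein_mult[OF u(1) v(1)] by (simp add: mult.assoc)
qed

section \<open>Sums over residues\<close>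

text \<open>
  An affine map with invertible slope permutes the residues modulo \<open>p\<close>. All changes of
  variable in character sums below are instances.
\<close>

lemma sum_residues_affine:
  fixes f :: "int \<Rightarrow> 'a::comm_monoid_add" and p :: nat
  assumes p: "prime p"
    and periodic: "\<And>x y. [x = y] (mod int p) \<Longrightarrow> f x = f y"
    and k: "\<not> int p dvd k"
  shows "(\<Sum>x\<in>{0..<int p}. f (k * x + c)) = (\<Sum>x\<in>{0..<int p}. f x)"
proof -
  let ?h = "\<lambda>x. (k * x + c) mod int p"
  have p0: "int p > 0" using p prime_gt_0_nat by simp
  have cop: "coprime k (int p)"
    using p k by (metis coprime_commute prime_imp_coprime prime_nat_int_transfer)
  have inj: "inj_on ?h {0..<int p}"
  proof (rule inj_onI)
    fix x y assume xy: "x \<in> {0..<int p}" "y \<in> {0..<int p}" "?h x = ?h y"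
    then have "[k * x + c = k * y + c] (mod int p)" by (simp add: cong_def)
    then have "[k * x = k * y] (mod int p)" by (simp add: cong_add_rcancel)
    then have "[x = y] (mod int p)" using cop by (simp add: cong_mult_lcancel)
    then show "x = y" using xy by (simp add: cong_def)
  qed
  have "?h ` {0..<int p} = {0..<int p}"
    by (rule card_subset_eq) (use p0 inj in \<open>auto simp: card_image\<close>)
  then have "bij_betw ?h {0..<int p} {0..<int p}" using inj by (simp add: bij_betw_def)
  then have "(\<Sum>x\<in>{0..<int p}. f (?h x)) = (\<Sum>x\<in>{0..<int p}. f x)"
    by (rule sum.reindex_bij_betw)
  moreover have "f (?h x) = f (k * x + c)" for x
    by (rule periodic) (simp add: cong_def)
  ultimately show ?thesis by simp
qed

section \<open>Cubic characters\<close>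

text \<open>
  Characters are functions on the integers that only depend on the residue and vanish on
  the multiples of \<open>p\<close>. The assumption \<open>kernel\<close> says that the character detects cubes, and
  \<open>nontrivial\<close> excludes the primes for which every residue is a cube.
\<close>

locale cubic_character =
  fixes p :: nat and \<chi> :: "int \<Rightarrow> complex"
  assumes prime: "prime p"
    and periodic: "[x = y] (mod int p) \<Longrightarrow> \<chi> x = \<chi> y"
    and mult: "\<chi> (x * y) = \<chi> x * \<chi> y"
    and zero: "int p dvd x \<Longrightarrow> \<chi> x = 0"
    and cube: "\<not> int p dvd x \<Longrightarrow> \<chi> x ^ 3 = 1"
    and kernel: "\<not> int p dvd x \<Longrightarrow> \<chi> x = 1 \<longleftrightarrow> (\<exists>y. [y ^ 3 = x] (mod int p))"
    and nontrivial: "\<exists>x. \<not> int p dvd x \<and> \<chi> x \<noteq> 1"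
begin

abbreviation R :: "int set" where "R \<equiv> {0..<int p}"

lemma not_dvd_1: "\<not> int p dvd 1"
  using prime prime_gt_1_nat by fastforce

lemma one: "\<chi> 1 = 1"
proof -
  have "[1 ^ 3 = 1] (mod int p)" by simp
  then show ?thesis using kernel[OF not_dvd_1] by blast
qed

lemma norm_unit:
  assumes "\<not> int p dvd x"
  shows "norm (\<chi> x) = 1"
proof -
  have "norm (\<chi> x) ^ 3 = 1" using cube[OF assms] by (metis norm_one norm_power)
  then show ?thesis
    using power_eq_imp_eq_base[of "norm (\<chi> x)" 3 1] by simp
qed

lemma unit_cnj:
  assumes "\<not> int p dvd x"
  shows "\<chi> x * cnj (\<chi> x) = 1"
  using norm_unit[OF assms] by (simp add: complex_norm_square[symmetric])

lemma dvd_residue_iff: "x \<in> R \<Longrightarrow> int p dvd x \<longleftrightarrow> x = 0"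
  using zdvd_not_zless[of x "int p"] by (cases "x = 0") auto

lemma sum_affine:
  assumes "\<And>x y. [x = y] (mod int p) \<Longrightarrow> f x = f y" "\<not> int p dvd k"
  shows "(\<Sum>x\<in>R. f (k * x + c)) = (\<Sum>x\<in>R. f x :: complex)"
  by (rule sum_residues_affine[OF prime assms])

lemma eisenstein_values: "\<chi> x \<in> eisenstein"
  using zero[of x] cube[of x] eisenstein_cube_root_of_unity eisenstein_of_int[of 0]
  by (cases "int p dvd x") auto

text \<open>
  Substituting \<open>k * t\<close> for \<open>t\<close> multiplies the sum by \<open>\<chi> k\<close>, which can be chosen different
  from 1. The same works for the square of the character, since a cube root of unity
  other than 1 also has a square other than 1.
\<close>

lemma sum_eq_0: "(\<Sum>t\<in>R. \<chi> t) = 0"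
proof -
  obtain k where k: "\<not> int p dvd k" "\<chi> k \<noteq> 1" using nontrivial by blast
  have "(\<Sum>t\<in>R. \<chi> t) = (\<Sum>t\<in>R. \<chi> (k * t + 0))"
    by (rule sum_affine[symmetric]) (use periodic k in auto)
  also have "\<dots> = \<chi> k * (\<Sum>t\<in>R. \<chi> t)" by (simp add: mult sum_distrib_left)
  finally show ?thesis using k(2) by simp
qed

lemma sum_square_eq_0: "(\<Sum>t\<in>R. \<chi> t ^ 2) = 0"
proof -
  obtain k where k: "\<not> int p dvd k" "\<chi> k \<noteq> 1" using nontrivial by blast
  have "\<chi> k ^ 2 \<noteq> 1"
  proof
    assume "\<chi> k ^ 2 = 1"
    with cube[OF k(1)] have "\<chi> k = 1" by (simp add: eval_nat_numeral)
    with k(2) show False by contradiction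
  qed
  moreover have "(\<Sum>t\<in>R. \<chi> t ^ 2) = \<chi> k ^ 2 * (\<Sum>t\<in>R. \<chi> t ^ 2)"
  proof -
    have "(\<Sum>t\<in>R. \<chi> t ^ 2) = (\<Sum>t\<in>R. \<chi> (k * t + 0) ^ 2)"
      by (rule sum_affine[symmetric]) (use k in \<open>auto dest: periodic\<close>)
    also have "\<dots> = \<chi> k ^ 2 * (\<Sum>t\<in>R. \<chi> t ^ 2)"
      by (simp add: mult sum_distrib_left power_mult_distrib)
    finally show ?thesis .
  qed
  ultimately show ?thesis by simp
qed

section \<open>The norm of the Jacobi sum\<close>

definition jacobi_sum :: complex where
  "jacobi_sum = (\<Sum>t\<in>R. \<chi> t * \<chi> (1 - t))"

text \<open>
  The squared modulus of the Jacobi sum comes from summing \<open>norm (convolution a) ^ 2\<close> over all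
  \<open>a\<close> in two ways. On one side, by scaling, each unit \<open>a\<close> contributes this squared modulus and
  \<open>a = 0\<close> contributes nothing. On the other side, expanding the squares produces
  the autocorrelations of the character, which are \<open>- 1\<close> except at the multiples of \<open>p\<close>.
\<close>

definition convolution :: "int \<Rightarrow> complex" where
  "convolution a = (\<Sum>t\<in>R. \<chi> t * \<chi> (a - t))"

lemma convolution_unit:
  assumes a: "\<not> int p dvd a"
  shows "convolution a = \<chi> a ^ 2 * jacobi_sum"
proof -
  have "convolution a = (\<Sum>t\<in>R. \<chi> (a * t + 0) * \<chi> (a - (a * t + 0)))"
    unfolding convolution_def
    by (rule sum_affine[symmetric, OF _ a])
       (metis periodic cong_diff cong_refl)
  also have "\<dots> = (\<Sum>t\<in>R. \<chi> a ^ 2 * (\<chi> t * \<chi> (1 - t)))"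
  proof (rule sum.cong)
    fix t
    have "a - (a * t + 0) = a * (1 - t)" by (simp add: algebra_simps)
    then show "\<chi> (a * t + 0) * \<chi> (a - (a * t + 0)) = \<chi> a ^ 2 * (\<chi> t * \<chi> (1 - t))"
      by (simp add: mult power2_eq_square)
  qed simp
  finally show ?thesis by (simp add: jacobi_sum_def sum_distrib_left)
qed

lemma convolution_0: "convolution 0 = 0"
proof -
  have "convolution 0 = (\<Sum>t\<in>R. \<chi> (- 1) * \<chi> t ^ 2)"
    unfolding convolution_def
  proof (rule sum.cong)
    fix t
    have "\<chi> (0 - t) = \<chi> (- 1) * \<chi> t" by (metis mult mult_minus1 diff_0)
    then show "\<chi> t * \<chi> (0 - t) = \<chi> (- 1) * \<chi> t ^ 2" by (simp add: power2_eq_square)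
  qed simp
  then show ?thesis using sum_square_eq_0 by (simp add: sum_distrib_left[symmetric])
qed

lemma card_units: "card (R - {0}) = p - 1"
  using prime prime_gt_0_nat by (simp add: card_Diff_singleton)

lemma sum_norms: "(\<Sum>t\<in>R. \<chi> t * cnj (\<chi> t)) = of_nat (p - 1)"
proof -
  have "(\<Sum>t\<in>R. \<chi> t * cnj (\<chi> t)) = (\<Sum>t\<in>R - {0}. \<chi> t * cnj (\<chi> t))"
    by (rule sum.mono_neutral_right) (auto simp: zero)
  also have "\<dots> = (\<Sum>t\<in>R - {0}. 1)"
    by (rule sum.cong) (auto simp: unit_cnj dvd_residue_iff simp del: atLeastLessThan_iff)
  finally show ?thesis by (simp add: card_units)
qed

definition correlation :: "int \<Rightarrow> complex" where
  "correlation d = (\<Sum>a\<in>R. \<chi> a * cnj (\<chi> (a + d)))"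

lemma correlation_unit_eq:
  assumes "\<not> int p dvd d"
  shows "correlation d = correlation 1"
proof -
  have "correlation d = (\<Sum>a\<in>R. \<chi> (d * a + 0) * cnj (\<chi> (d * a + 0 + d)))"
    unfolding correlation_def
    by (rule sum_affine[symmetric, OF _ assms])
       (metis periodic cong_add cong_refl)
  also have "\<dots> = (\<Sum>a\<in>R. \<chi> a * cnj (\<chi> (a + 1)))"
  proof (rule sum.cong)
    fix a
    have "d * a + 0 + d = d * (a + 1)" by (simp add: algebra_simps)
    then have "\<chi> (d * a + 0) * cnj (\<chi> (d * a + 0 + d))
        = (\<chi> d * cnj (\<chi> d)) * (\<chi> a * cnj (\<chi> (a + 1)))"
      by (simp add: mult)
    then show "\<chi> (d * a + 0) * cnj (\<chi> (d * a + 0 + d)) = \<chi> a * cnj (\<chi> (a + 1))"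
      by (simp add: unit_cnj[OF assms])
  qed simp
  finally show ?thesis by (simp add: correlation_def)
qed

lemma correlation_zero: "int p dvd d \<Longrightarrow> correlation d = of_nat (p - 1)"
proof -
  assume "int p dvd d"
  then have "\<chi> (a + d) = \<chi> a" for a
    by (intro periodic) (simp add: cong_iff_dvd_diff)
  then show ?thesis by (simp add: correlation_def sum_norms)
qed

text \<open>
  The correlations at all units agree, so it is enough to know their sum. Summing over all shifts
  \<open>d\<close> gives 0, because the inner sum runs over all values of \<open>\<chi>\<close>; the shift
  \<open>d = 0\<close> accounts for \<open>p - 1\<close>, and the \<open>p - 1\<close> units share the rest.
\<close>

lemma correlation_unit:
  assumes "\<not> int p dvd d"
  shows "correlation d = - 1"
proof -
  have p1: "p > 1" using prime prime_gt_1_nat by blast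
  have "(\<Sum>d\<in>R. correlation d) = (\<Sum>a\<in>R. \<chi> a * cnj (\<Sum>d\<in>R. \<chi> (1 * d + a)))"
    unfolding correlation_def by (subst sum.swap) (simp add: sum_distrib_left add.commute)
  also have "\<dots> = 0"
    by (subst sum_affine) (use periodic not_dvd_1 sum_eq_0 in auto)
  finally have "correlation 0 + (\<Sum>d\<in>R - {0}. correlation d) = 0"
    using p1 by (subst (asm) sum.remove[of _ 0]) auto
  moreover have "(\<Sum>d\<in>R - {0}. correlation d) = (\<Sum>d\<in>R - {0}. correlation 1)"
    by (rule sum.cong) (auto intro!: correlation_unit_eq simp: dvd_residue_iff simp del: atLeastLessThan_iff)
  ultimately have "of_nat (p - 1) * (1 + correlation 1) = 0"
    by (simp add: correlation_zero card_units algebra_simps)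
  then have "correlation 1 = - 1" using p1 by (auto simp: add_eq_0_iff)
  then show ?thesis using correlation_unit_eq[OF assms] by simp
qed

text \<open>
  With \<open>correlation d = p * [d = 0] - 1\<close>, the double sum over \<open>t\<close> and \<open>s\<close> has a diagonal part,
  equal to \<open>p * (p - 1)\<close>, and a part which is a product of two vanishing character sums.
\<close>

lemma jacobi_sum_norm: "jacobi_sum * cnj jacobi_sum = of_nat p"
proof -
  have p1: "p > 1" using prime prime_gt_1_nat by blast
  have "(\<Sum>a\<in>R. convolution a * cnj (convolution a)) = (\<Sum>a\<in>R - {0}. convolution a * cnj (convolution a))"
    by (rule sum.mono_neutral_right) (auto simp: convolution_0)
  also have "\<dots> = (\<Sum>a\<in>R - {0}. jacobi_sum * cnj jacobi_sum)"
  proof (rule sum.cong)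
    fix a assume "a \<in> R - {0}"
    then have a: "\<not> int p dvd a" by (simp add: dvd_residue_iff del: atLeastLessThan_iff)
    have "convolution a * cnj (convolution a) = (\<chi> a * cnj (\<chi> a)) ^ 2 * (jacobi_sum * cnj jacobi_sum)"
      by (simp add: convolution_unit[OF a] power2_eq_square)
    then show "convolution a * cnj (convolution a) = jacobi_sum * cnj jacobi_sum" by (simp add: unit_cnj[OF a])
  qed simp
  finally have 1: "(\<Sum>a\<in>R. convolution a * cnj (convolution a)) = of_nat (p - 1) * (jacobi_sum * cnj jacobi_sum)"
    by (simp add: card_units)
  have inner: "(\<Sum>a\<in>R. \<chi> (a - t) * cnj (\<chi> (a - s))) = correlation (t - s)" for t s
  proof -
    have "(\<Sum>a\<in>R. \<chi> (1 * a + (- t)) * cnj (\<chi> (1 * a + (- t) + (t - s)))) = correlation (t - s)"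
      unfolding correlation_def
      by (rule sum_affine[OF _ not_dvd_1]) (metis periodic cong_add cong_refl)
    then show ?thesis by simp
  qed
  have "(\<Sum>a\<in>R. convolution a * cnj (convolution a))
      = (\<Sum>a\<in>R. \<Sum>t\<in>R. \<Sum>s\<in>R. \<chi> t * cnj (\<chi> s) * (\<chi> (a - t) * cnj (\<chi> (a - s))))"
    by (simp add: convolution_def sum_product algebra_simps)
  also have "\<dots> = (\<Sum>t\<in>R. \<Sum>a\<in>R. \<Sum>s\<in>R. \<chi> t * cnj (\<chi> s) * (\<chi> (a - t) * cnj (\<chi> (a - s))))"
    by (rule sum.swap)
  also have "\<dots> = (\<Sum>t\<in>R. \<Sum>s\<in>R. \<Sum>a\<in>R. \<chi> t * cnj (\<chi> s) * (\<chi> (a - t) * cnj (\<chi> (a - s))))"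
    by (intro sum.cong refl sum.swap)
  also have "\<dots> = (\<Sum>t\<in>R. \<Sum>s\<in>R. \<chi> t * cnj (\<chi> s) * correlation (t - s))"
    by (simp add: inner sum_distrib_left[symmetric])
  also have "\<dots> = (\<Sum>t\<in>R. \<Sum>s\<in>R. \<chi> t * cnj (\<chi> s) * ((if t = s then of_nat p else 0) - 1))"
  proof (intro sum.cong refl)
    fix t s assume "t \<in> R" "s \<in> R"
    then have "int p dvd t - s \<longleftrightarrow> t = s"
      by (simp add: mod_eq_dvd_iff[symmetric])
    then have "correlation (t - s) = (if t = s then of_nat p else 0) - 1"
      using correlation_zero[of "t - s"] correlation_unit[of "t - s"] p1 by (auto simp: of_nat_diff)
    then show "\<chi> t * cnj (\<chi> s) * correlation (t - s)
        = \<chi> t * cnj (\<chi> s) * ((if t = s then of_nat p else 0) - 1)" by simp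
  qed
  also have "\<dots> = (\<Sum>t\<in>R. \<Sum>s\<in>R. if t = s then \<chi> t * cnj (\<chi> s) * of_nat p else 0)
      - (\<Sum>t\<in>R. \<chi> t) * (\<Sum>s\<in>R. cnj (\<chi> s))"
    unfolding sum_product sum_subtractf[symmetric]
    by (intro sum.cong refl) (simp add: algebra_simps)
  also have "\<dots> = of_nat (p - 1) * of_nat p"
    by (simp add: sum_eq_0 sum_norms sum_distrib_right[symmetric])
  finally show ?thesis using 1 p1 by simp
qed

section \<open>The Jacobi sum modulo 3 and modulo 2\<close>

text \<open>
  For \<open>t\<close> other than 0 and 1, the product \<open>(1 - \<chi> t) * (1 - \<chi> (1 - t))\<close> is a multiple of 3. Summing
  its expansion over these \<open>t\<close> gives \<open>(p - 2) + 1 + 1 + jacobi_sum\<close>, since the sum of \<open>\<chi>\<close>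
  over all residues is 0.
\<close>

lemma jacobi_sum_mod_3:
  obtains e where "e \<in> eisenstein" "jacobi_sum = - of_nat p + 3 * e"
proof -
  have p1: "p > 1" using prime prime_gt_1_nat by blast
  define T where "T = R - {0, 1}"
  have unit: "\<not> int p dvd t" "\<not> int p dvd 1 - t" if "t \<in> T" for t
  proof -
    show "\<not> int p dvd t" using that dvd_residue_iff[of t] by (auto simp: T_def)
    have "int p dvd 1 - t \<longleftrightarrow> t = 1"
      using that p1 by (simp add: T_def mod_eq_dvd_iff[symmetric])
    then show "\<not> int p dvd 1 - t" using that by (auto simp: T_def)
  qed
  have split: "sum f R = f 0 + f 1 + sum f T" for f :: "int \<Rightarrow> complex"
  proof -
    have "R = insert 0 (insert 1 T)" using p1 by (auto simp: T_def)
    moreover have "finite T" "0 \<notin> T" "1 \<notin> T" by (auto simp: T_def)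
    ultimately show ?thesis by (simp add: add.assoc)
  qed
  have chi0: "\<chi> 0 = 0" by (simp add: zero)
  have "\<exists>e. e \<in> eisenstein \<and> (1 - \<chi> t) * (1 - \<chi> (1 - t)) = 3 * e" if "t \<in> T" for t
    using one_minus_cube_roots_prod[OF cube[OF unit(1)[OF that]] cube[OF unit(2)[OF that]]]
    by metis
  then obtain e where e: "\<And>t. t \<in> T \<Longrightarrow> e t \<in> eisenstein"
      "\<And>t. t \<in> T \<Longrightarrow> (1 - \<chi> t) * (1 - \<chi> (1 - t)) = 3 * e t" by metis
  have "3 * sum e T = (\<Sum>t\<in>T. (1 - \<chi> t) * (1 - \<chi> (1 - t)))"
    using e(2) by (simp add: sum_distrib_left)
  also have "\<dots> = of_nat (card T) - (\<Sum>t\<in>T. \<chi> t) - (\<Sum>t\<in>T. \<chi> (1 - t))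
      + (\<Sum>t\<in>T. \<chi> t * \<chi> (1 - t))"
    by (simp add: algebra_simps sum.distrib sum_subtractf)
  also have "(\<Sum>t\<in>T. \<chi> t) = - 1"
    using split[of \<chi>] by (simp add: sum_eq_0 chi0 one add_eq_0_iff)
  also have "(\<Sum>t\<in>T. \<chi> (1 - t)) = - 1"
  proof -
    have "(\<Sum>t\<in>R. \<chi> (- 1 * t + 1)) = (\<Sum>t\<in>R. \<chi> t)"
      by (rule sum_affine) (use periodic not_dvd_1 in auto)
    then show ?thesis
      using split[of "\<lambda>t. \<chi> (1 - t)"] by (simp add: sum_eq_0 chi0 one add_eq_0_iff)
  qed
  also have "(\<Sum>t\<in>T. \<chi> t * \<chi> (1 - t)) = jacobi_sum"
    using split[of "\<lambda>t. \<chi> t * \<chi> (1 - t)"] by (simp add: jacobi_sum_def chi0)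
  also have "card T = p - 2"
    using p1 by (simp add: T_def card_Diff_subset)
  also have "of_nat (p - 2) = (of_nat p - 2 :: complex)"
    using p1 by (simp add: of_nat_diff)
  finally have "jacobi_sum = - of_nat p + 3 * sum e T" by (simp add: algebra_simps)
  with that eisenstein_sum[of T e] e(1) show thesis by blast
qed

text \<open>
  The terms at \<open>t\<close> and \<open>1 - t\<close> coincide. Only the residue \<open>1 / 2\<close> is fixed by this symmetry, and
  its term is \<open>\<chi> (1 / 2) ^ 2 = \<chi> 2 ^ (- 2) = \<chi> 2\<close>, as \<open>\<chi> 2\<close> is a cube root of unity.
\<close>

lemma jacobi_sum_mod_2:
  assumes "odd p"
  obtains e where "e \<in> eisenstein" "jacobi_sum = \<chi> 2 + 2 * e"
proof -
  obtain m where m: "int p = 2 * m + 1"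
    using assms by (metis even_of_nat oddE)
  have m1: "m \<ge> 1"
    using m prime prime_ge_2_nat[of p] by linarith
  \<comment> \<open>The residue of \<open>1 / 2\<close> is \<open>m + 1\<close>, and \<open>t \<mapsto> 2 * m + 2 - t\<close> represents
      \<open>t \<mapsto> 1 - t\<close> on the residues from 2 to \<open>2 * m\<close>.\<close>
  let ?f = "\<lambda>t. \<chi> t * \<chi> (1 - t)"
  have sym: "?f (2 * m + 2 - t) = ?f t" for t
  proof -
    have "\<chi> (2 * m + 2 - t) = \<chi> (1 - t)"
      by (rule periodic) (simp add: cong_iff_dvd_diff m add.commute)
    moreover have "\<chi> (1 - (2 * m + 2 - t)) = \<chi> t"
      by (rule periodic[symmetric]) (simp add: cong_iff_dvd_diff m)
    ultimately show ?thesis by simp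
  qed
  have mid: "?f (m + 1) = \<chi> 2"
  proof -
    have "\<chi> (1 - (m + 1)) = \<chi> (m + 1)"
      by (rule periodic[symmetric]) (simp add: cong_iff_dvd_diff m)
    moreover have "\<chi> 2 * \<chi> (m + 1) = 1"
    proof -
      have "\<chi> (2 * (m + 1)) = \<chi> 1"
        by (rule periodic) (simp add: cong_iff_dvd_diff m add.commute)
      then show ?thesis by (metis mult one)
    qed
    moreover from this have "\<not> int p dvd 2" using zero by fastforce
    then have "\<chi> 2 ^ 3 = 1" by (rule cube)
    moreover have "b * b = a" if "a * b = 1" "a ^ 3 = 1" for a b :: complex
    proof -
      have "b * b = a ^ 3 * (b * b)" using that by simp
      also have "\<dots> = (a * b) * (a * b) * a" by (simp add: eval_nat_numeral)
      finally show ?thesis using that by simp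
    qed
    ultimately show ?thesis by simp
  qed
  have "R = insert 0 (insert 1 (insert (m + 1) ({2..m} \<union> {m + 2..2 * m})))"
    using m m1 by auto
  then have "jacobi_sum = ?f 0 + (?f 1 + (?f (m + 1) + (sum ?f {2..m} + sum ?f {m + 2..2 * m})))"
    unfolding jacobi_sum_def using m1 by (simp add: sum.union_disjoint)
  moreover have "sum ?f {m + 2..2 * m} = sum ?f {2..m}"
    by (rule sum.reindex_bij_witness[of _ "\<lambda>t. 2 * m + 2 - t" "\<lambda>t. 2 * m + 2 - t"])
       (use sym in auto)
  ultimately have "jacobi_sum = \<chi> 2 + 2 * sum ?f {2..m}"
    using mid by (simp add: zero)
  moreover have "sum ?f {2..m} \<in> eisenstein"
    by (intro eisenstein_sum eisenstein_mult eisenstein_values)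
  ultimately show thesis using that by blast
qed

end

section \<open>Existence of a cubic character\<close>

text \<open>
  With a primitive root \<open>g\<close>, send \<open>g ^ i\<close> to \<open>omega ^ i\<close>. The exponent is determined modulo \<open>p - 1\<close>,
  a multiple of 3, so this is well defined; and \<open>g ^ i\<close> is a cube exactly when 3 divides \<open>i\<close>.
\<close>

lemma cubic_character_exists:
  assumes p: "prime p" and p3: "[p = 1] (mod 3)"
  shows "\<exists>\<chi>. cubic_character p \<chi>"
proof -
  have p1: "p > 1" using p prime_gt_1_nat by blast
  obtain g where g: "residue_primroot p g" using prime_primitive_root_exists[OF p1 p] by blast
  then have cop: "coprime p g" and ord: "ord p g = p - 1"
    using p by (auto simp: residue_primroot_def totient_prime)
  have "3 dvd p - 1" using p3 p1 by (metis cong_altdef_nat less_imp_le)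
  have ndvd_g: "\<not> int p dvd int g ^ i" for i
  proof
    assume "int p dvd int g ^ i"
    then have "p dvd g" using p by (metis int_dvd_int_iff of_nat_power prime_dvd_power)
    then show False using cop p1 by (simp add: coprime_absorb_left)
  qed
  have power_cong: "[i = j] (mod 3)" if "[int g ^ i = int g ^ j] (mod int p)" for i j
  proof -
    have "[g ^ i = g ^ j] (mod p)" using that by (metis cong_int_iff of_nat_power)
    then have "[i = j] (mod (p - 1))" using order_divides_expdiff[OF cop] ord by simp
    then show ?thesis using \<open>3 dvd p - 1\<close> by (rule cong_dvd_modulus_nat)
  qed
  have ex_index: "\<exists>i. [x = int g ^ i] (mod int p)" if x: "\<not> int p dvd x" for x
  proof -
    define r where "r = nat (x mod int p)"
    have r: "int r = x mod int p" using p1 by (simp add: r_def)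
    moreover have "0 < x mod int p" "x mod int p < int p"
      using x p1 pos_mod_sign[of "int p" x] by (auto simp: dvd_eq_mod_eq_0 intro!: le_neq_trans)
    ultimately have "0 < r" "r < p" by linarith+
    then have "r \<in> totatives p" using p by (simp add: totatives_prime)
    then obtain i where "r = g ^ i mod p"
      using residue_primroot_is_generator[OF p1 g] unfolding bij_betw_def by blast
    then have "x mod int p = int g ^ i mod int p" using r by (metis of_nat_mod of_nat_power)
    then show ?thesis by (auto simp: cong_def)
  qed
  define ind where "ind x = (SOME i. [x = int g ^ i] (mod int p))" for x
  define \<chi> where "\<chi> x = (if int p dvd x then 0 else omega ^ ind x)" for x
  have \<chi>_power: "\<chi> x = omega ^ i" if "[x = int g ^ i] (mod int p)" for x i
  proof -
    have "[x = int g ^ ind x] (mod int p)" unfolding ind_def using that by (rule someI)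
    then have "[int g ^ ind x = int g ^ i] (mod int p)" using that by (metis cong_sym cong_trans)
    moreover have "\<not> int p dvd x" using that ndvd_g cong_dvd_iff by blast
    ultimately show ?thesis by (simp add: \<chi>_def omega_power_cong power_cong)
  qed
  have "cubic_character p \<chi>"
  proof
    show "prime p" by (rule p)
  next
    fix x y assume xy: "[x = y] (mod int p)"
    show "\<chi> x = \<chi> y"
    proof (cases "int p dvd x")
      case True
      then show ?thesis using xy by (metis \<chi>_def cong_dvd_iff)
    next
      case False
      then obtain i where "[x = int g ^ i] (mod int p)" using ex_index by blast
      then show ?thesis using xy \<chi>_power by (metis cong_sym cong_trans)
    qed
  next
    fix x y
    show "\<chi> (x * y) = \<chi> x * \<chi> y"
    proof (cases "int p dvd x \<or> int p dvd y")
      case True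
      then show ?thesis by (auto simp: \<chi>_def)
    next
      case False
      then obtain i j where ij: "[x = int g ^ i] (mod int p)" "[y = int g ^ j] (mod int p)"
        using ex_index by blast
      then have "[x * y = int g ^ (i + j)] (mod int p)" unfolding power_add by (rule cong_mult)
      then have "\<chi> (x * y) = omega ^ (i + j)" by (rule \<chi>_power)
      then show ?thesis using ij by (simp add: \<chi>_power power_add)
    qed
  next
    fix x assume "int p dvd x"
    then show "\<chi> x = 0" by (simp add: \<chi>_def)
  next
    fix x assume "\<not> int p dvd x"
    then have "\<chi> x ^ 3 = (omega ^ 3) ^ ind x" by (simp add: \<chi>_def power_mult[symmetric] mult.commute)
    then show "\<chi> x ^ 3 = 1" by (simp add: omega_cubed)
  next
    fix x assume x: "\<not> int p dvd x"
    show "\<chi> x = 1 \<longleftrightarrow> (\<exists>y. [y ^ 3 = x] (mod int p))"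
    proof
      assume "\<chi> x = 1"
      moreover obtain i where i: "[x = int g ^ i] (mod int p)" using ex_index[OF x] by blast
      ultimately have "3 dvd i" by (simp add: \<chi>_power omega_power_eq_1_imp)
      then obtain k where "i = k * 3" by (metis dvdE mult.commute)
      then have "[(int g ^ k) ^ 3 = x] (mod int p)"
        using i by (simp add: power_mult[symmetric] cong_sym)
      then show "\<exists>y. [y ^ 3 = x] (mod int p)" by blast
    next
      assume "\<exists>y. [y ^ 3 = x] (mod int p)"
      then obtain y where y: "[y ^ 3 = x] (mod int p)" by blast
      then have "\<not> int p dvd y" using x by (metis cong_dvd_iff dvd_power zero_less_numeral dvd_trans)
      then obtain j where "[y = int g ^ j] (mod int p)" using ex_index by blast
      then have "[y ^ 3 = int g ^ (j * 3)] (mod int p)" unfolding power_mult by (rule cong_pow)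
      then have "\<chi> x = omega ^ (j * 3)" using y by (metis \<chi>_power cong_sym cong_trans)
      also have "\<dots> = 1" using omega_power_cong[of "j * 3" 0] by (simp add: cong_def)
      finally show "\<chi> x = 1" .
    qed
  next
    have "\<chi> (int g) = omega" using \<chi>_power[of "int g" 1] by simp
    then show "\<exists>x. \<not> int p dvd x \<and> \<chi> x \<noteq> 1"
      using ndvd_g[of 1] omega_neq_1 by (intro exI[of _ "int g"]) simp
  qed
  then show ?thesis by blast
qed

section \<open>Quadratic forms\<close>

text \<open>
  The two representations give elements \<open>L + M \<surd>(-27)\<close> and \<open>C + D \<surd>(-27)\<close> of norms \<open>4 * p\<close> and \<open>p\<close>.
  The prime \<open>p\<close> divides \<open>L * D - C * M\<close> or \<open>L * D + C * M\<close>, and by Brahmagupta's identity that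
  number is too small to be a nonzero multiple of \<open>p\<close>. Hence \<open>M\<^sup>2 = 4 * D\<^sup>2\<close>.
\<close>

lemma representation_parity:
  fixes L M C D :: int
  assumes p: "prime p" and 4: "4 * int p = L\<^sup>2 + 27 * M\<^sup>2" and 1: "int p = C\<^sup>2 + 27 * D\<^sup>2"
  shows "even M"
proof -
  have p0: "int p > 0" using p prime_gt_0_nat by simp
  have factor: "(L * D - C * M) * (L * D + C * M) = int p * (4 * D\<^sup>2 - M\<^sup>2)"
  proof -
    have "int p * (4 * D\<^sup>2 - M\<^sup>2) = (4 * int p) * D\<^sup>2 - int p * M\<^sup>2" by (simp add: algebra_simps)
    also have "\<dots> = (L\<^sup>2 + 27 * M\<^sup>2) * D\<^sup>2 - (C\<^sup>2 + 27 * D\<^sup>2) * M\<^sup>2" unfolding 4 by (simp only: 1)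
    finally show ?thesis by (simp add: algebra_simps power2_eq_square)
  qed
  \<comment> \<open>Stated for \<open>N\<close> so that it applies to both \<open>M\<close> and \<open>- M\<close>.\<close>
  have vanish: "L * D - C * N = 0"
    if N: "N\<^sup>2 = M\<^sup>2" and dvd: "int p dvd L * D - C * N" for N
  proof -
    obtain k where k: "L * D - C * N = int p * k" using dvd by (elim dvdE)
    have "(L * C + 27 * N * D)\<^sup>2 + 27 * (L * D - C * N)\<^sup>2 = (L\<^sup>2 + 27 * N\<^sup>2) * (C\<^sup>2 + 27 * D\<^sup>2)"
      by (simp add: algebra_simps power2_eq_square)
    also have "\<dots> = 4 * (int p)\<^sup>2" unfolding N 4[symmetric] 1[symmetric] by (simp add: power2_eq_square)
    finally have "27 * (int p * k)\<^sup>2 \<le> 4 * (int p)\<^sup>2"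
      unfolding k using zero_le_power2[of "L * C + 27 * N * D"] by linarith
    then have "(27 * k\<^sup>2) * (int p)\<^sup>2 \<le> 4 * (int p)\<^sup>2" by (simp add: power_mult_distrib mult_ac)
    then have "27 * k\<^sup>2 \<le> 4" using p0 by (simp add: mult_le_cancel_right)
    then have "k\<^sup>2 = 0" using zero_le_power2[of k] by linarith
    then show ?thesis using k by simp
  qed
  have "int p dvd (L * D - C * M) * (L * D + C * M)" by (simp add: factor)
  then have "int p dvd L * D - C * M \<or> int p dvd L * D - C * (- M)"
    using p prime_dvd_mult_iff[of "int p"] by simp
  then have "(L * D - C * M) * (L * D + C * M) = 0"
    using vanish[of M] vanish[of "- M"] by auto
  then have "M\<^sup>2 = 4 * D\<^sup>2" using factor p0 by simp
  then have "even (M\<^sup>2)" by simp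
  then show ?thesis by simp
qed

theorem theorem4:
  fixes p :: nat
  assumes "prime p" and "[p = 1] (mod 3)"
  shows "(\<exists>x::int. [x ^ 3 = 2] (mod int p)) \<longleftrightarrow>
         (\<exists>C D :: int. int p = C\<^sup>2 + 27 * D\<^sup>2)"
proof -
  have odd: "odd p"
  proof
    assume "even p"
    then have "p = 2" using primes_dvd_imp_eq[OF two_is_prime_nat assms(1)] by simp
    then show False using assms(2) by (simp add: cong_def)
  qed
  have n2: "\<not> int p dvd 2"
  proof
    assume "int p dvd 2"
    then have "p dvd 2" using int_dvd_int_iff[of p 2] by simp
    then show False using primes_dvd_imp_eq[OF assms(1) two_is_prime_nat] odd by simp
  qed
  obtain \<chi> where "cubic_character p \<chi>"
    using cubic_character_exists[OF assms] by blast
  then interpret cubic_character p \<chi> .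
  obtain u where u: "u \<in> eisenstein" "jacobi_sum = - of_nat p + 3 * u" by (rule jacobi_sum_mod_3)
  obtain v where v: "v \<in> eisenstein" "jacobi_sum = \<chi> 2 + 2 * v" by (rule jacobi_sum_mod_2[OF odd])
  obtain a' B where u': "u = of_int a' + of_int B * omega" using u(1) by (rule eisensteinE)
  define a where "a = 3 * a' - int p"
  have J: "jacobi_sum = of_int a + of_int (3 * B) * omega"
    by (simp add: u(2) u' a_def algebra_simps)
  have "of_int (a\<^sup>2 - a * (3 * B) + (3 * B)\<^sup>2) = (of_int (int p) :: complex)"
    using jacobi_sum_norm unfolding J eisenstein_norm by simp
  then have norm: "int p = a\<^sup>2 - a * (3 * B) + (3 * B)\<^sup>2"
    by (simp only: of_int_eq_iff)
  have rep: "4 * int p = (2 * a - 3 * B)\<^sup>2 + 27 * B\<^sup>2"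
    by (simp add: norm algebra_simps power2_eq_square)
  \<comment> \<open>Comparing the coefficients of \<open>omega\<close> modulo 2; \<open>3 * B\<close> and \<open>B\<close> have the same parity.\<close>
  have parity: "\<chi> 2 = 1 \<longleftrightarrow> even B"
  proof -
    obtain c d where v': "v = of_int c + of_int d * omega" using v(1) by (rule eisensteinE)
    from cube_root_of_unity_cases[OF cube[OF n2]]
    consider "\<chi> 2 = 1" | "\<chi> 2 = omega" | "\<chi> 2 = - 1 - omega" by blast
    then show ?thesis
    proof cases
      case 1
      then have "jacobi_sum = of_int (1 + 2 * c) + of_int (2 * d) * omega"
        by (simp add: v(2) v' algebra_simps)
      then have "3 * B = 2 * d" using eisenstein_coords_unique(2) J by metis
      with 1 show ?thesis by presburger
    next
      case 2
      then have "jacobi_sum = of_int (2 * c) + of_int (1 + 2 * d) * omega"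
        by (simp add: v(2) v' algebra_simps)
      then have "3 * B = 1 + 2 * d" using eisenstein_coords_unique(2) J by metis
      with 2 omega_neq_1 show ?thesis by presburger
    next
      case 3
      then have "jacobi_sum = of_int (- 1 + 2 * c) + of_int (- 1 + 2 * d) * omega"
        by (simp add: v(2) v' algebra_simps)
      then have "3 * B = - 1 + 2 * d" using eisenstein_coords_unique(2) J by metis
      moreover have "\<chi> 2 \<noteq> 1" by (simp add: 3 omega_def complex_eq_iff)
      ultimately show ?thesis by presburger
    qed
  qed
  have "even B \<longleftrightarrow> (\<exists>C D :: int. int p = C\<^sup>2 + 27 * D\<^sup>2)"
  proof
    assume "even B"
    then obtain D where "B = 2 * D" by (elim evenE)
    then have "int p = (a - 3 * D)\<^sup>2 + 27 * D\<^sup>2"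
      using norm by (simp add: algebra_simps power2_eq_square)
    then show "\<exists>C D :: int. int p = C\<^sup>2 + 27 * D\<^sup>2" by blast
  next
    assume "\<exists>C D :: int. int p = C\<^sup>2 + 27 * D\<^sup>2"
    then show "even B" using representation_parity[OF assms(1) rep] by blast
  qed
  then show ?thesis using kernel[OF n2] parity by blast
qed

end
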